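(* Let $M$ be a 3-dimensional Riemannian manifold with metric tensor $g$ and $(1,1)$-tensor fields (affinors) $q$ and $S$ whose components in the local coordinates $(X^1,X^2,X^3)$ on a coordinate neighborhood $F\subset\mathbb{R}^3$ are the matrices $(g_{ij})$, $(q_i^{.j})$, $(S_i^{.j})$ given in the context, with $A,B$ smooth functions on $F$ satisfying $A>B>0$. Then $q$ is parallel with respect to the Riemannian connection $\nabla$ of $g$ (i.e. $\nabla q=0$) if and only if $$\operatorname{grad} A=\operatorname{grad} B\cdot S .$$
   Context: The component matrices are $$(g_{ij})=\begin{pmatrix} A & B & B \\ B & A & B \\ B & B & A \end{pmatrix},\quad (q_i^{.j})=\begin{pmatrix} 0 & 1 & 0 \\ 0 & 0 & 1 \\ 1 & 0 & 0 \end{pmatrix},\quad (S_i^{.j})=\begin{pmatrix} -1 & 1 & 1 \\ 1 & -1 & 1 \\ 1 & 1 & -1 \end{pmatrix},$$ where $A=A(X^1,X^2,X^3)$ and $B=B(X^1,X^2,X^3)$ are smooth functions on $F$ with $A>B>0$. Here the lower index is the row index and $q e_i=\sum_j q_i^{.j}e_j$ for the coordinate basis $e_i=\partial/\partial X^i$. $\nabla$ is the Levi-Civita connection of $g$. For a smooth function $\Phi$ on $F$ write $\Phi_i=\partial\Phi/\partial X^i$, and $\operatorname{grad}\Phi=(\Phi_1,\Phi_2,\Phi_3)$ is the row vector of partial derivatives; $\operatorname{grad}B\cdot S$ is the product of this row vector with the matrix $S$. All statements are understood on $F$. *)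

theory Defs
  imports "HOL-Analysis.Analysis"
begin

text \<open>
  \<open>Ck_on k F f\<close> is meant for open \<open>F\<close>: iterated directional derivatives of \<open>f\<close> up to order \<open>k\<close>
  exist and are continuous on \<open>F\<close>.  Values of \<open>f\<close> outside \<open>F\<close> are irrelevant.
\<close>

primrec Ck_on ::
  "nat \<Rightarrow> 'a::real_normed_vector set \<Rightarrow> ('a \<Rightarrow> 'b::real_normed_vector) \<Rightarrow> bool" where
  "Ck_on 0 F f \<longleftrightarrow> continuous_on F f"
| "Ck_on (Suc k) F f \<longleftrightarrow>
     (\<forall>x\<in>F. f differentiable at x) \<and> (\<forall>v. Ck_on k F (\<lambda>x. frechet_derivative f (at x) v))"

definition smooth_on ::
  "'a::real_normed_vector set \<Rightarrow> ('a \<Rightarrow> 'b::real_normed_vector) \<Rightarrow> bool" where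
  "smooth_on F f \<longleftrightarrow> (\<forall>k. Ck_on k F f)"

definition partial_deriv :: "'n::finite \<Rightarrow> (real^'n \<Rightarrow> real) \<Rightarrow> real^'n \<Rightarrow> real" where
  "partial_deriv i f x = frechet_derivative f (at x) (axis i 1)"

definition grad :: "(real^'n \<Rightarrow> real) \<Rightarrow> real^'n \<Rightarrow> real^'n" where
  "grad f x = (\<chi> i. partial_deriv i f x)"

text \<open>
  Tensor fields on a chart are given by their components: a metric by the matrices
  \<open>g x $ i $ j\<close> $= g_{ij}(x)$, a vector field by its coefficients \<open>X x $ i\<close> $= X^i(x)$ with
  respect to the coordinate basis, and an affinor by the matrices \<open>Q x $ i $ j\<close>
  $= Q_i^{.j}(x)$, the lower index being the row index.
\<close>

definition riemannian_metric_on :: "(real^'n) set \<Rightarrow> (real^'n \<Rightarrow> real^'n^'n) \<Rightarrow> bool" where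
  "riemannian_metric_on F g \<longleftrightarrow>
     (\<forall>i j. smooth_on F (\<lambda>x. g x $ i $ j)) \<and>
     (\<forall>x\<in>F. transpose (g x) = g x \<and> (\<forall>v. v \<noteq> 0 \<longrightarrow> v \<bullet> (g x *v v) > 0))"

text \<open>\<open>christoffel g k i j x\<close> is $\Gamma^k_{ij}(x)$.\<close>

definition christoffel ::
  "(real^'n \<Rightarrow> real^'n^'n) \<Rightarrow> 'n \<Rightarrow> 'n \<Rightarrow> 'n \<Rightarrow> real^'n \<Rightarrow> real" where
  "christoffel g k i j x =
     (\<Sum>l\<in>UNIV. matrix_inv (g x) $ k $ l *
        (partial_deriv i (\<lambda>y. g y $ j $ l) x
         + partial_deriv j (\<lambda>y. g y $ i $ l) x
         - partial_deriv l (\<lambda>y. g y $ i $ j) x)) / 2"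

text \<open>
  \<open>levi_civita g X Y\<close> is $\nabla_X Y$.  That it is torsion-free and compatible with \<open>g\<close> is shown
  in \<open>levi_civita_torsion_free\<close> and \<open>levi_civita_metric\<close> below.
\<close>

definition levi_civita ::
  "(real^'n \<Rightarrow> real^'n^'n) \<Rightarrow> (real^'n \<Rightarrow> real^'n) \<Rightarrow> (real^'n \<Rightarrow> real^'n) \<Rightarrow> real^'n \<Rightarrow> real^'n" where
  "levi_civita g X Y x =
     (\<chi> k. \<Sum>i\<in>UNIV. X x $ i * (partial_deriv i (\<lambda>y. Y y $ k) x
             + (\<Sum>j\<in>UNIV. christoffel g k i j x * Y x $ j)))"

text \<open>
  Since \<open>Q\<close> maps $e_i$ to $\sum_j Q_i^{.j} e_j$, it sends the coefficients of a vector field,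
  seen as a row vector, to their product with the matrix of \<open>Q\<close> on the right.
\<close>

definition apply_affinor ::
  "(real^'n \<Rightarrow> real^'n^'n) \<Rightarrow> (real^'n \<Rightarrow> real^'n) \<Rightarrow> real^'n \<Rightarrow> real^'n" where
  "apply_affinor Q Y x = Y x v* Q x"

text \<open>\<open>nabla_affinor g Q X Y\<close> is $(\nabla_X Q)Y = \nabla_X(QY) - Q(\nabla_X Y)$.\<close>

definition nabla_affinor ::
  "(real^'n \<Rightarrow> real^'n^'n) \<Rightarrow> (real^'n \<Rightarrow> real^'n^'n) \<Rightarrow>
   (real^'n \<Rightarrow> real^'n) \<Rightarrow> (real^'n \<Rightarrow> real^'n) \<Rightarrow> real^'n \<Rightarrow> real^'n" where
  "nabla_affinor g Q X Y x =
     levi_civita g X (apply_affinor Q Y) x - apply_affinor Q (levi_civita g X Y) x"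

definition parallel_affinor_on ::
  "(real^'n) set \<Rightarrow> (real^'n \<Rightarrow> real^'n^'n) \<Rightarrow> (real^'n \<Rightarrow> real^'n^'n) \<Rightarrow> bool" where
  "parallel_affinor_on F g Q \<longleftrightarrow>
     (\<forall>X Y. smooth_on F X \<longrightarrow> smooth_on F Y \<longrightarrow> (\<forall>x\<in>F. nabla_affinor g Q X Y x = 0))"

definition metric_matrix :: "(real^3 \<Rightarrow> real) \<Rightarrow> (real^3 \<Rightarrow> real) \<Rightarrow> real^3 \<Rightarrow> real^3^3" where
  "metric_matrix A B x = vector [vector [A x, B x, B x],
                                 vector [B x, A x, B x],
                                 vector [B x, B x, A x]]"

definition q_matrix :: "real^3^3" where
  "q_matrix = vector [vector [0, 1, 0],
                      vector [0, 0, 1],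
                      vector [1, 0, 0]]"

definition S_matrix :: "real^3^3" where
  "S_matrix = vector [vector [-1, 1, 1],
                      vector [1, -1, 1],
                      vector [1, 1, -1]]"

lemma smooth_on_differentiable: "smooth_on F f \<Longrightarrow> x \<in> F \<Longrightarrow> f differentiable at x"
  unfolding smooth_on_def by (metis Ck_on.simps(2))

lemma partial_deriv_eq_deriv:
  assumes "f differentiable at x"
  shows "partial_deriv i f x = deriv (\<lambda>t. f (x + t *\<^sub>R axis i 1)) 0"
proof -
  let ?D = "frechet_derivative f (at x)"
  have D: "(f has_derivative ?D) (at x)"
    using assms frechet_derivative_works by blast
  have g: "((\<lambda>t::real. x + t *\<^sub>R axis i 1) has_derivative (\<lambda>t. t *\<^sub>R axis i 1)) (at 0)"
    by (auto intro!: derivative_eq_intros)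
  have "((\<lambda>t. f (x + t *\<^sub>R axis i 1)) has_derivative (\<lambda>t. ?D (t *\<^sub>R axis i 1))) (at 0)"
    using has_derivative_compose[OF g, of f ?D] D by simp
  moreover have "(\<lambda>t::real. ?D (t *\<^sub>R axis i 1)) = (*) (?D (axis i 1))"
    using linear_frechet_derivative[OF assms] by (auto simp: linear_scale mult.commute)
  ultimately have "((\<lambda>t. f (x + t *\<^sub>R axis i 1)) has_field_derivative ?D (axis i 1)) (at 0)"
    by (simp add: has_field_derivative_def)
  then show ?thesis
    by (simp add: DERIV_imp_deriv partial_deriv_def)
qed

lemma frechet_eq_sum_partial_deriv:
  fixes f :: "real^'n \<Rightarrow> real"
  assumes "f differentiable at x"
  shows "frechet_derivative f (at x) v = (\<Sum>i\<in>UNIV. v $ i * partial_deriv i f x)"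
proof -
  have L: "linear (frechet_derivative f (at x))"
    using assms by (rule linear_frechet_derivative)
  have "v = (\<Sum>i\<in>UNIV. v $ i *\<^sub>R axis i 1)"
    by (simp add: basis_expansion scalar_mult_eq_scaleR[symmetric])
  then have "frechet_derivative f (at x) v
      = frechet_derivative f (at x) (\<Sum>i\<in>UNIV. v $ i *\<^sub>R axis i 1)"
    by (rule arg_cong)
  also have "\<dots> = (\<Sum>i\<in>UNIV. v $ i * partial_deriv i f x)"
    by (simp add: linear_sum[OF L] linear_scale[OF L] partial_deriv_def)
  finally show ?thesis .
qed

lemma partial_deriv_mult:
  assumes "f differentiable at x" "h differentiable at x"
  shows "partial_deriv i (\<lambda>y. f y * h y) x = partial_deriv i f x * h x + f x * partial_deriv i h x"
proof -
  have "((\<lambda>y. f y * h y) has_derivative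
      (\<lambda>v. f x * frechet_derivative h (at x) v + frechet_derivative f (at x) v * h x)) (at x)"
    using assms by (intro has_derivative_mult) (simp_all add: frechet_derivative_works)
  from frechet_derivative_at[OF this] show ?thesis
    unfolding partial_deriv_def by (metis (no_types, lifting) add.commute)
qed

lemma partial_deriv_sum:
  fixes f :: "'b \<Rightarrow> real^'n \<Rightarrow> real"
  assumes "\<And>a. a \<in> I \<Longrightarrow> f a differentiable at x"
  shows "partial_deriv i (\<lambda>y. \<Sum>a\<in>I. f a y) x = (\<Sum>a\<in>I. partial_deriv i (f a) x)"
proof -
  have "((\<lambda>y. \<Sum>a\<in>I. f a y) has_derivative
      (\<lambda>v. \<Sum>a\<in>I. frechet_derivative (f a) (at x) v)) (at x)"
    using assms by (intro has_derivative_sum) (simp add: frechet_derivative_works)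
  from frechet_derivative_at[OF this] show ?thesis
    unfolding partial_deriv_def by metis
qed

lemma riemannian_metric_symmetric:
  assumes "riemannian_metric_on F g" "x \<in> F"
  shows "g x $ i $ j = g x $ j $ i"
proof -
  have "transpose (g x) = g x"
    using assms by (simp add: riemannian_metric_on_def)
  from arg_cong[OF this, of "\<lambda>M. M $ j $ i"] show ?thesis
    by (simp add: transpose_def)
qed

lemma riemannian_metric_inverse:
  assumes "riemannian_metric_on F g" "x \<in> F"
  shows "g x ** matrix_inv (g x) = mat 1"
proof -
  have "v = 0" if "g x *v v = 0" for v
    using assms that unfolding riemannian_metric_on_def by fastforce
  then have "invertible (g x)"
    unfolding invertible_left_inverse matrix_left_invertible_ker by blast
  then show ?thesis
    unfolding invertible_def matrix_inv_def by (rule someI_ex[THEN conjunct1])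
qed

lemma christoffel_lower:
  assumes "riemannian_metric_on F g" "x \<in> F"
  shows "(\<Sum>k\<in>UNIV. g x $ m $ k * christoffel g k i j x) =
     (partial_deriv i (\<lambda>y. g y $ j $ m) x + partial_deriv j (\<lambda>y. g y $ i $ m) x
         - partial_deriv m (\<lambda>y. g y $ i $ j) x) / 2"
proof -
  let ?t = "\<lambda>l. (partial_deriv i (\<lambda>y. g y $ j $ l) x + partial_deriv j (\<lambda>y. g y $ i $ l) x
         - partial_deriv l (\<lambda>y. g y $ i $ j) x)"
  have e: "(\<Sum>k\<in>UNIV. g x $ m $ k * matrix_inv (g x) $ k $ l) = (if m = l then 1 else 0)" for l
    using arg_cong[OF riemannian_metric_inverse[OF assms], of "\<lambda>M. M $ m $ l"]
    by (simp add: matrix_matrix_mult_def mat_def)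
  have "(\<Sum>k\<in>UNIV. g x $ m $ k * christoffel g k i j x)
     = (\<Sum>k\<in>UNIV. \<Sum>l\<in>UNIV. g x $ m $ k * matrix_inv (g x) $ k $ l * ?t l) / 2"
    unfolding christoffel_def
    by (simp add: sum_divide_distrib sum_distrib_left mult.assoc)
  also have "\<dots> = (\<Sum>l\<in>UNIV. (\<Sum>k\<in>UNIV. g x $ m $ k * matrix_inv (g x) $ k $ l) * ?t l) / 2"
    by (subst sum.swap) (simp only: sum_distrib_right)
  also have "\<dots> = ?t m / 2"
    unfolding e by (simp add: if_distrib[of "\<lambda>z. z * _"] cong: if_cong)
  finally show ?thesis .
qed

lemma partial_deriv_cong_on:
  assumes "open F" "x \<in> F" "\<And>y. y \<in> F \<Longrightarrow> f y = h y" "h differentiable at x"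
  shows "partial_deriv i f x = partial_deriv i h x"
proof -
  have "(f has_derivative frechet_derivative h (at x)) (at x)"
    using assms by (metis frechet_derivative_works has_derivative_transform_within_open)
  then show ?thesis
    unfolding partial_deriv_def by (metis frechet_derivative_at)
qed

lemma christoffel_symmetric:
  assumes "riemannian_metric_on F g" "open F" "x \<in> F"
  shows "christoffel g k i j x = christoffel g k j i x"
proof -
  have "partial_deriv l (\<lambda>y. g y $ i $ j) x = partial_deriv l (\<lambda>y. g y $ j $ i) x" for l
  proof (rule partial_deriv_cong_on[OF assms(2,3)])
    show "g y $ i $ j = g y $ j $ i" if "y \<in> F" for y
      using riemannian_metric_symmetric[OF assms(1) that] .
    show "(\<lambda>y. g y $ j $ i) differentiable at x"
      using assms by (intro smooth_on_differentiable[of F]) (auto simp: riemannian_metric_on_def)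
  qed
  then show ?thesis
    unfolding christoffel_def by (simp add: add.commute)
qed

lemma levi_civita_torsion_free:
  assumes "riemannian_metric_on F g" "open F" "x \<in> F"
  shows "levi_civita g X Y x - levi_civita g Y X x =
    (\<chi> k. \<Sum>i\<in>UNIV. X x $ i * partial_deriv i (\<lambda>y. Y y $ k) x
                   - Y x $ i * partial_deriv i (\<lambda>y. X y $ k) x)"
proof -
  have "(\<Sum>i\<in>UNIV. \<Sum>j\<in>UNIV. X x $ i * (christoffel g k i j x * Y x $ j))
      = (\<Sum>i\<in>UNIV. \<Sum>j\<in>UNIV. Y x $ i * (christoffel g k i j x * X x $ j))" for k
    by (subst sum.swap) (simp add: christoffel_symmetric[OF assms, of k] mult_ac)
  then show ?thesis
    unfolding levi_civita_def vec_eq_iff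
    by (simp add: distrib_left sum.distrib sum_subtractf sum_distrib_left)
qed

lemma levi_civita_metric:
  fixes g :: "real^'n \<Rightarrow> real^'n^'n"
  assumes R: "riemannian_metric_on F g" "open F" and x: "x \<in> F"
    and Y: "smooth_on F Y" and Z: "smooth_on F Z"
  shows "frechet_derivative (\<lambda>y. Y y \<bullet> (g y *v Z y)) (at x) (X x) =
    levi_civita g X Y x \<bullet> (g x *v Z x) + Y x \<bullet> (g x *v levi_civita g X Z x)"
proof -
  let ?p = "\<lambda>i a b. partial_deriv i (\<lambda>y. g y $ a $ b) x"
  have dY: "(\<lambda>y. Y y $ a) differentiable at x" for a
    using smooth_on_differentiable[OF Y x]
    by (auto simp: differentiable_def intro: bounded_linear.has_derivative[OF bounded_linear_vec_nth])
  have dZ: "(\<lambda>y. Z y $ a) differentiable at x" for a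
    using smooth_on_differentiable[OF Z x]
    by (auto simp: differentiable_def intro: bounded_linear.has_derivative[OF bounded_linear_vec_nth])
  have dg: "(\<lambda>y. g y $ a $ b) differentiable at x" for a b
    using R x by (intro smooth_on_differentiable[of F]) (auto simp: riemannian_metric_on_def)
  have sym: "?p i a b = ?p i b a" for i a b
    by (rule partial_deriv_cong_on[OF R(2) x riemannian_metric_symmetric[OF R(1)] dg])
  have compat: "?p i a b = (\<Sum>k\<in>UNIV. g x $ k $ b * christoffel g k i a x)
      + (\<Sum>k\<in>UNIV. g x $ a $ k * christoffel g k i b x)" for i a b
  proof -
    have "(\<Sum>k\<in>UNIV. g x $ k $ b * christoffel g k i a x)
        = (\<Sum>k\<in>UNIV. g x $ b $ k * christoffel g k i a x)"
      by (rule sum.cong[OF refl]) (simp only: riemannian_metric_symmetric[OF R(1) x, of _ b])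
    moreover have "?p i a b = (?p i a b + ?p a i b - ?p b i a) / 2 + (?p i a b + ?p b i a - ?p a i b) / 2"
      by (simp add: field_simps)
    ultimately show ?thesis
      by (simp only: christoffel_lower[OF R(1) x] sym[of i b a])
  qed
  have e0: "(\<lambda>y. Y y \<bullet> (g y *v Z y)) = (\<lambda>y. \<Sum>a\<in>UNIV. \<Sum>b\<in>UNIV. Y y $ a * (g y $ a $ b * Z y $ b))"
    by (simp add: inner_vec_def matrix_vector_mult_def sum_distrib_left)
  have e1: "frechet_derivative
      (\<lambda>y. \<Sum>a\<in>UNIV. \<Sum>b\<in>UNIV. Y y $ a * (g y $ a $ b * Z y $ b)) (at x) (X x) =
    (\<Sum>i\<in>UNIV. X x $ i * (\<Sum>a\<in>UNIV. \<Sum>b\<in>UNIV.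
        partial_deriv i (\<lambda>y. Y y $ a) x * (g x $ a $ b * Z x $ b)
      + Y x $ a * (?p i a b * Z x $ b + g x $ a $ b * partial_deriv i (\<lambda>y. Z y $ b) x)))"
    using dY dZ dg
    by (simp add: frechet_eq_sum_partial_deriv partial_deriv_sum partial_deriv_mult)
  have e2: "(\<Sum>a\<in>UNIV. \<Sum>b\<in>UNIV.
        partial_deriv i (\<lambda>y. Y y $ a) x * (g x $ a $ b * Z x $ b)
      + Y x $ a * (?p i a b * Z x $ b + g x $ a $ b * partial_deriv i (\<lambda>y. Z y $ b) x))
    = (\<Sum>a\<in>UNIV. \<Sum>b\<in>UNIV. (partial_deriv i (\<lambda>y. Y y $ a) x
          + (\<Sum>j\<in>UNIV. christoffel g a i j x * Y x $ j)) * (g x $ a $ b * Z x $ b))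
     + (\<Sum>a\<in>UNIV. \<Sum>b\<in>UNIV. Y x $ a * (g x $ a $ b * (partial_deriv i (\<lambda>y. Z y $ b) x
          + (\<Sum>j\<in>UNIV. christoffel g b i j x * Z x $ j))))" (is "?L = ?R") for i
  proof -
    have 1: "(\<Sum>a\<in>UNIV. \<Sum>b\<in>UNIV. (\<Sum>j\<in>UNIV. christoffel g a i j x * Y x $ j) * (g x $ a $ b * Z x $ b))
       = (\<Sum>a\<in>UNIV. \<Sum>b\<in>UNIV. Y x $ a * ((\<Sum>k\<in>UNIV. g x $ k $ b * christoffel g k i a x) * Z x $ b))"
    proof -
      have "(\<Sum>a\<in>UNIV. \<Sum>b\<in>UNIV. (\<Sum>j\<in>UNIV. christoffel g a i j x * Y x $ j) * (g x $ a $ b * Z x $ b))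
        = (\<Sum>b\<in>UNIV. \<Sum>a\<in>UNIV. \<Sum>j\<in>UNIV. christoffel g a i j x * Y x $ j * (g x $ a $ b * Z x $ b))"
        by (subst sum.swap) (simp only: sum_distrib_right)
      also have "\<dots> = (\<Sum>b\<in>UNIV. \<Sum>j\<in>UNIV. \<Sum>a\<in>UNIV. christoffel g a i j x * Y x $ j * (g x $ a $ b * Z x $ b))"
        by (rule sum.cong[OF refl], rule sum.swap)
      also have "\<dots> = (\<Sum>j\<in>UNIV. \<Sum>b\<in>UNIV. \<Sum>a\<in>UNIV. christoffel g a i j x * Y x $ j * (g x $ a $ b * Z x $ b))"
        by (rule sum.swap)
      finally show ?thesis
        by (simp add: sum_distrib_right sum_distrib_left mult_ac)
    qed
    have 2: "(\<Sum>a\<in>UNIV. \<Sum>b\<in>UNIV. Y x $ a * (g x $ a $ b * (\<Sum>j\<in>UNIV. christoffel g b i j x * Z x $ j)))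
       = (\<Sum>a\<in>UNIV. \<Sum>b\<in>UNIV. Y x $ a * ((\<Sum>k\<in>UNIV. g x $ a $ k * christoffel g k i b x) * Z x $ b))"
    proof (rule sum.cong[OF refl])
      fix a
      have "(\<Sum>b\<in>UNIV. Y x $ a * (g x $ a $ b * (\<Sum>j\<in>UNIV. christoffel g b i j x * Z x $ j)))
        = (\<Sum>j\<in>UNIV. \<Sum>b\<in>UNIV. Y x $ a * (g x $ a $ b * (christoffel g b i j x * Z x $ j)))"
        by (subst sum.swap) (simp only: sum_distrib_left)
      then show "(\<Sum>b\<in>UNIV. Y x $ a * (g x $ a $ b * (\<Sum>j\<in>UNIV. christoffel g b i j x * Z x $ j)))
        = (\<Sum>b\<in>UNIV. Y x $ a * ((\<Sum>k\<in>UNIV. g x $ a $ k * christoffel g k i b x) * Z x $ b))"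
        by (simp add: sum_distrib_right sum_distrib_left mult_ac)
    qed
    show ?thesis
      unfolding compat[of i]
      by (simp only: distrib_left distrib_right sum.distrib 1 2 add_ac)
  qed
  have e3: "levi_civita g X Y x \<bullet> (g x *v Z x) =
    (\<Sum>i\<in>UNIV. X x $ i * (\<Sum>a\<in>UNIV. \<Sum>b\<in>UNIV. (partial_deriv i (\<lambda>y. Y y $ a) x
          + (\<Sum>j\<in>UNIV. christoffel g a i j x * Y x $ j)) * (g x $ a $ b * Z x $ b)))"
  proof -
    let ?h = "\<lambda>i a. partial_deriv i (\<lambda>y. Y y $ a) x + (\<Sum>j\<in>UNIV. christoffel g a i j x * Y x $ j)"
    let ?w = "\<lambda>a. \<Sum>b\<in>UNIV. g x $ a $ b * Z x $ b"
    have "levi_civita g X Y x \<bullet> (g x *v Z x) = (\<Sum>a\<in>UNIV. \<Sum>i\<in>UNIV. X x $ i * ?h i a * ?w a)"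
      unfolding inner_vec_def levi_civita_def matrix_vector_mult_def vec_lambda_beta inner_real_def
      by (rule sum.cong[OF refl], rule sum_distrib_right)
    also have "\<dots> = (\<Sum>i\<in>UNIV. \<Sum>a\<in>UNIV. X x $ i * ?h i a * ?w a)"
      by (rule sum.swap)
    finally show ?thesis
      by (simp only: sum_distrib_left mult.assoc)
  qed
  have e4: "Y x \<bullet> (g x *v levi_civita g X Z x) =
    (\<Sum>i\<in>UNIV. X x $ i * (\<Sum>a\<in>UNIV. \<Sum>b\<in>UNIV. Y x $ a * (g x $ a $ b *
          (partial_deriv i (\<lambda>y. Z y $ b) x + (\<Sum>j\<in>UNIV. christoffel g b i j x * Z x $ j)))))"
  proof -
    let ?h = "\<lambda>i b. partial_deriv i (\<lambda>y. Z y $ b) x + (\<Sum>j\<in>UNIV. christoffel g b i j x * Z x $ j)"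
    have "Y x \<bullet> (g x *v levi_civita g X Z x) =
       (\<Sum>a\<in>UNIV. \<Sum>b\<in>UNIV. \<Sum>i\<in>UNIV. Y x $ a * (g x $ a $ b * (X x $ i * ?h i b)))"
      unfolding inner_vec_def levi_civita_def matrix_vector_mult_def vec_lambda_beta inner_real_def
      by (intro sum.cong refl) (subst sum_distrib_left, intro sum.cong refl, subst sum_distrib_left,
          subst sum_distrib_left, rule refl)
    also have "\<dots> = (\<Sum>a\<in>UNIV. \<Sum>i\<in>UNIV. \<Sum>b\<in>UNIV. Y x $ a * (g x $ a $ b * (X x $ i * ?h i b)))"
      by (rule sum.cong[OF refl], rule sum.swap)
    also have "\<dots> = (\<Sum>i\<in>UNIV. \<Sum>a\<in>UNIV. \<Sum>b\<in>UNIV. Y x $ a * (g x $ a $ b * (X x $ i * ?h i b)))"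
      by (rule sum.swap)
    also have "\<dots> = (\<Sum>i\<in>UNIV. \<Sum>a\<in>UNIV. \<Sum>b\<in>UNIV. X x $ i * (Y x $ a * (g x $ a $ b * ?h i b)))"
      by (simp only: mult.left_commute[of _ "X x $ _"])
    finally show ?thesis by (simp only: sum_distrib_left)
  qed
  show ?thesis
    unfolding e0 e1 e2 e3 e4
    by (subst sum.distrib[symmetric], rule sum.cong[OF refl], rule distrib_left)
qed

lemma metric_matrix_riemannian:
  assumes "smooth_on F A" "smooth_on F B" "\<forall>x\<in>F. A x > B x \<and> B x > 0"
  shows "riemannian_metric_on F (metric_matrix A B)"
proof -
  have "v \<bullet> (metric_matrix A B x *v v) > 0" if "x \<in> F" "v \<noteq> 0" for x v
  proof -
    have "v \<bullet> (metric_matrix A B x *v v) =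
        (A x - B x) * (v \<bullet> v) + B x * (v $ 1 + v $ 2 + v $ 3)\<^sup>2"
      by (simp add: metric_matrix_def inner_vec_def matrix_vector_mult_def sum_3
          algebra_simps power2_eq_square)
    also have "\<dots> > 0"
      using assms(3) that by (intro add_pos_nonneg mult_pos_pos mult_nonneg_nonneg) (auto intro: less_imp_le)
    finally show ?thesis .
  qed
  moreover have "\<forall>i j. smooth_on F (\<lambda>x. metric_matrix A B x $ i $ j)"
    using assms by (simp add: forall_3 metric_matrix_def)
  moreover have "transpose (metric_matrix A B x) = metric_matrix A B x" for x
    by (simp add: metric_matrix_def transpose_def vec_eq_iff forall_3)
  ultimately show ?thesis
    by (auto simp: riemannian_metric_on_def)
qed

end

(* For a constant affinor the derivative terms of its covariant derivative cancel, so being parallel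
   means that it commutes with the Christoffel symbols. The affinor q permutes the coordinate basis
   cyclically and preserves the circulant metric, so this may be tested on the Christoffel symbols
   with lowered index; there the condition is linear in the partial derivatives of A and B. *)
theory Submission
  imports Defs
begin

lemma Ck_on_const: "Ck_on k F (\<lambda>_. c)"
  by (induction k arbitrary: c) simp_all

lemma smooth_on_const: "smooth_on F (\<lambda>_. c)"
  by (simp add: smooth_on_def Ck_on_const)

lemma partial_deriv_const [simp]: "partial_deriv i (\<lambda>_. c) x = 0"
  by (simp add: partial_deriv_def)

lemma differentiable_vec_nth:
  assumes "f differentiable at x"
  shows "(\<lambda>y. f y $ a) differentiable at x"
  using assms
  by (auto simp: differentiable_def intro: bounded_linear.has_derivative[OF bounded_linear_vec_nth])

text \<open>As \<open>Q\<close> has constant components it passes through partial derivatives, so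
  the derivatives of \<open>Y\<close> enter \<open>nabla_X (Q Y)\<close> and
  \<open>Q (nabla_X Y)\<close> alike and cancel. What remains is bilinear in the values of
  \<open>X\<close> and \<open>Y\<close> at \<open>x\<close>.\<close>

lemma nabla_const_affinor:
  fixes g :: "real^'n \<Rightarrow> real^'n^'n"
  assumes Y: "Y differentiable at x"
  shows "nabla_affinor g (\<lambda>_. Q) X Y x $ k =
    (\<Sum>i\<in>UNIV. \<Sum>j\<in>UNIV. X x $ i * Y x $ j *
      ((\<Sum>s\<in>UNIV. Q $ j $ s * christoffel g k i s x)
       - (\<Sum>s\<in>UNIV. Q $ s $ k * christoffel g s i j x)))"
proof -
  have d: "partial_deriv i (\<lambda>y. \<Sum>s\<in>UNIV. Q $ s $ k * Y y $ s) x
      = (\<Sum>s\<in>UNIV. Q $ s $ k * partial_deriv i (\<lambda>y. Y y $ s) x)" for i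
    using differentiable_vec_nth[OF Y]
    by (simp add: partial_deriv_sum partial_deriv_mult)
  \<comment> \<open>Facts \<open>1\<close>, \<open>2\<close> and \<open>3\<close> exchange sums so
    that the components of \<open>Y\<close> and \<open>X\<close> become outer factors.\<close>
  have 1: "(\<Sum>j\<in>UNIV. christoffel g k i j x * (\<Sum>s\<in>UNIV. Q $ s $ j * Y x $ s))
      = (\<Sum>j\<in>UNIV. Y x $ j * (\<Sum>s\<in>UNIV. Q $ j $ s * christoffel g k i s x))" for i
    by (simp only: sum_distrib_left, subst sum.swap) (simp only: mult_ac)
  have 2: "(\<Sum>s\<in>UNIV. Q $ s $ k * (\<Sum>j\<in>UNIV. christoffel g s i j x * Y x $ j))
      = (\<Sum>j\<in>UNIV. Y x $ j * (\<Sum>s\<in>UNIV. Q $ s $ k * christoffel g s i j x))" for i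
    by (simp only: sum_distrib_left, subst sum.swap) (simp only: mult_ac)
  have 3: "(\<Sum>s\<in>UNIV. Q $ s $ k * (\<Sum>i\<in>UNIV. X x $ i * h s i))
      = (\<Sum>i\<in>UNIV. X x $ i * (\<Sum>s\<in>UNIV. Q $ s $ k * h s i))" for h
    by (simp only: sum_distrib_left, subst sum.swap) (simp only: mult_ac)
  have "nabla_affinor g (\<lambda>_. Q) X Y x $ k =
      (\<Sum>i\<in>UNIV. X x $ i *
        (partial_deriv i (\<lambda>y. \<Sum>s\<in>UNIV. Q $ s $ k * Y y $ s) x
         + (\<Sum>j\<in>UNIV. christoffel g k i j x * (\<Sum>s\<in>UNIV. Q $ s $ j * Y x $ s))))
    - (\<Sum>s\<in>UNIV. Q $ s $ k * (\<Sum>i\<in>UNIV. X x $ i *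
        (partial_deriv i (\<lambda>y. Y y $ s) x + (\<Sum>j\<in>UNIV. christoffel g s i j x * Y x $ j))))"
    by (simp add: nabla_affinor_def levi_civita_def apply_affinor_def vector_matrix_mult_def mult.commute)
  also have "\<dots> = (\<Sum>i\<in>UNIV. X x $ i *
      ((\<Sum>j\<in>UNIV. Y x $ j * (\<Sum>s\<in>UNIV. Q $ j $ s * christoffel g k i s x))
       - (\<Sum>j\<in>UNIV. Y x $ j * (\<Sum>s\<in>UNIV. Q $ s $ k * christoffel g s i j x))))"
    by (simp only: 3 d 1 2 sum_subtractf[symmetric] right_diff_distrib[symmetric]
        distrib_left[of "Q $ _ $ _"] sum.distrib add_diff_cancel_left)
  finally show ?thesis
    by (simp only: sum_subtractf right_diff_distrib sum_distrib_left mult.assoc)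
qed

text \<open>The bilinear form of \<open>nabla_const_affinor\<close> vanishes as soon as it does so
  on the coordinate fields, which are constant and hence smooth.\<close>

lemma parallel_const_affinor_iff:
  fixes g :: "real^'n \<Rightarrow> real^'n^'n"
  shows "parallel_affinor_on F g (\<lambda>_. Q) \<longleftrightarrow>
    (\<forall>x\<in>F. \<forall>i j k. (\<Sum>s\<in>UNIV. Q $ j $ s * christoffel g k i s x)
                 = (\<Sum>s\<in>UNIV. Q $ s $ k * christoffel g s i j x))"
    (is "?P \<longleftrightarrow> ?C")
proof
  assume P: ?P
  show ?C
  proof (intro ballI allI)
    fix x i j k assume "x \<in> F"
    \<comment> \<open>In the double sum the test on the outer index also sits inside the inner sum;
      it must be pulled out before the outer sum can collapse.\<close>
    have sum_if: "(\<Sum>b\<in>UNIV. if P then h b else 0) = (if P then \<Sum>b\<in>UNIV. h b else 0)"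
      for P and h :: "'n \<Rightarrow> real"
      by simp
    have "nabla_affinor g (\<lambda>_. Q) (\<lambda>_. axis i 1) (\<lambda>_. axis j 1) x $ k = 0"
      using P \<open>x \<in> F\<close> by (simp add: parallel_affinor_on_def smooth_on_const)
    then show "(\<Sum>s\<in>UNIV. Q $ j $ s * christoffel g k i s x)
        = (\<Sum>s\<in>UNIV. Q $ s $ k * christoffel g s i j x)"
      by (simp add: nabla_const_affinor axis_def sum_if
          if_distrib[of "\<lambda>z. z * _"] cong: if_cong)
  qed
next
  assume ?C
  then show ?P
    by (simp add: parallel_affinor_on_def vec_eq_iff nabla_const_affinor smooth_on_differentiable)
qed

text \<open>The matrix is \<open>a - b\<close> times the identity plus \<open>b\<close> times the
  all-ones matrix. Adding the equations determines the sum of the unknowns, since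
  \<open>a + 2 * b > 0\<close>; each row then determines its own unknown, since
  \<open>a - b > 0\<close>.\<close>

lemma circulant_injective:
  fixes a b u1 u2 u3 v1 v2 v3 :: real
  assumes "a > b" "b > 0"
    and "a * u1 + b * u2 + b * u3 = a * v1 + b * v2 + b * v3"
    and "b * u1 + a * u2 + b * u3 = b * v1 + a * v2 + b * v3"
    and "b * u1 + b * u2 + a * u3 = b * v1 + b * v2 + a * v3"
  shows "u1 = v1 \<and> u2 = v2 \<and> u3 = v3"
proof -
  have "(a + 2 * b) * (u1 + u2 + u3) = (a + 2 * b) * (v1 + v2 + v3)"
    using assms(3-5) by (simp add: algebra_simps)
  then have s: "u1 + u2 + u3 = v1 + v2 + v3"
    using assms(1,2) by simp
  have cancel: "u = v" if "(a - b) * u + b * (u1 + u2 + u3) = (a - b) * v + b * (v1 + v2 + v3)" for u v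
    using that assms(1) unfolding s by simp
  show ?thesis
    using cancel[of u1 v1] cancel[of u2 v2] cancel[of u3 v3] assms(3-5) by argo
qed

lemma q_commutes_christoffel_iff:
  fixes A B :: "real^3 \<Rightarrow> real"
  assumes R: "riemannian_metric_on F (metric_matrix A B)" and x: "x \<in> F"
    and pos: "A x > B x" "B x > 0"
  defines "\<Gamma> \<equiv> \<lambda>k i j. christoffel (metric_matrix A B) k i j x"
  shows "(\<forall>i j k. (\<Sum>s\<in>UNIV. q_matrix $ j $ s * \<Gamma> k i s) = (\<Sum>s\<in>UNIV. q_matrix $ s $ k * \<Gamma> s i j))
    \<longleftrightarrow> grad A x = grad B x v* S_matrix"
proof -
  \<comment> \<open>These are the Christoffel symbols of the first kind, with the upper index
    lowered to \<open>m\<close>.\<close>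
  define L where "L m i j = (partial_deriv i (\<lambda>y. metric_matrix A B y $ j $ m) x
    + partial_deriv j (\<lambda>y. metric_matrix A B y $ i $ m) x
    - partial_deriv m (\<lambda>y. metric_matrix A B y $ i $ j) x) / 2" for m i j
  have "(\<Sum>k\<in>UNIV. metric_matrix A B x $ m $ k * \<Gamma> k i j) = L m i j" for m i j
    unfolding \<Gamma>_def L_def by (rule christoffel_lower[OF R x])
  from this[of 1] this[of 2] this[of 3]
  have low: "L 1 i j = A x * \<Gamma> 1 i j + B x * \<Gamma> 2 i j + B x * \<Gamma> 3 i j"
            "L 2 i j = B x * \<Gamma> 1 i j + A x * \<Gamma> 2 i j + B x * \<Gamma> 3 i j"
            "L 3 i j = B x * \<Gamma> 1 i j + B x * \<Gamma> 2 i j + A x * \<Gamma> 3 i j" for i j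
    by (simp_all add: metric_matrix_def sum_3)
  \<comment> \<open>Lowering an index commutes with its cyclic shift because the metric is
    circulant, and it is injective.\<close>
  have shift: "\<Gamma> 2 i j' = \<Gamma> 1 i j \<and> \<Gamma> 3 i j' = \<Gamma> 2 i j \<and> \<Gamma> 1 i j' = \<Gamma> 3 i j \<longleftrightarrow>
      L 2 i j' = L 1 i j \<and> L 3 i j' = L 2 i j \<and> L 1 i j' = L 3 i j" (is "?G \<longleftrightarrow> ?L") for i j j'
  proof
    assume ?G
    then show ?L by (simp add: low)
  next
    assume ?L
    then show ?G
      using circulant_injective[OF pos, of "\<Gamma> 2 i j'" "\<Gamma> 3 i j'" "\<Gamma> 1 i j'" "\<Gamma> 1 i j" "\<Gamma> 2 i j" "\<Gamma> 3 i j"]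
      by (simp add: low algebra_simps)
  qed
  \<comment> \<open>The pairs \<open>(j, j')\<close> are those with \<open>q\<close> sending the
    \<open>j\<close>-th basis vector to the \<open>j'\<close>-th. Commuting with \<open>q\<close>
    thus means invariance under a simultaneous cyclic shift of \<open>k\<close> and
    \<open>j\<close>, with \<open>i\<close> fixed.\<close>
  have "(\<forall>i j k. (\<Sum>s\<in>UNIV. q_matrix $ j $ s * \<Gamma> k i s) = (\<Sum>s\<in>UNIV. q_matrix $ s $ k * \<Gamma> s i j))
    \<longleftrightarrow> (\<forall>i. \<forall>(j, j')\<in>{(1, 2), (2, 3), (3, 1)}.
          \<Gamma> 2 i j' = \<Gamma> 1 i j \<and> \<Gamma> 3 i j' = \<Gamma> 2 i j \<and> \<Gamma> 1 i j' = \<Gamma> 3 i j)"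
    by (simp add: q_matrix_def sum_3 forall_3) metis
  also have "\<dots> \<longleftrightarrow> (\<forall>i. \<forall>(j, j')\<in>{(1, 2), (2, 3), (3, 1)}.
          L 2 i j' = L 1 i j \<and> L 3 i j' = L 2 i j \<and> L 1 i j' = L 3 i j)"
    by (simp only: shift)
  \<comment> \<open>These are 27 linear equations in the partial derivatives of \<open>A\<close> and
    \<open>B\<close>; together they amount to \<open>A_1 = - B_1 + B_2 + B_3\<close> and its two
    cyclic analogues.\<close>
  also have "\<dots> \<longleftrightarrow> grad A x = grad B x v* S_matrix"
    by (simp add: L_def metric_matrix_def S_matrix_def grad_def vector_matrix_mult_def vec_eq_iff
        forall_3 sum_3) argo
  finally show ?thesis .
qed

theorem theorem1:
  fixes F :: "(real^3) set" and A B :: "real^3 \<Rightarrow> real"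
  assumes "open F"
    and "smooth_on F A" and "smooth_on F B"
    and "\<forall>x\<in>F. A x > B x \<and> B x > 0"
  shows "parallel_affinor_on F (metric_matrix A B) (\<lambda>_. q_matrix) \<longleftrightarrow>
         (\<forall>x\<in>F. grad A x = grad B x v* S_matrix)"
proof -
  note R = metric_matrix_riemannian[OF assms(2-4)]
  show ?thesis
    unfolding parallel_const_affinor_iff
    using q_commutes_christoffel_iff[OF R] assms(4) by (intro ball_cong refl) blast
qed

end
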